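(* Let $\mathcal{H}_2$ be the family of all subgraphs of the hexagonal grids $H_{m,n}$, over all positive integers $m,n$. Then the oriented chromatic number of this family satisfies $\chi_o(\mathcal{H}_2) \ge 6$.
   Context: All graphs are finite simple graphs or orientations of such graphs. An orientation $\vec{G}$ of a simple graph $G$ is a digraph obtained from $G$ by assigning to each edge exactly one of its two possible directions; $A(\vec{G})$ denotes its set of arcs. A digraph obtained in this way is called an oriented graph. An oriented $k$-coloring of an oriented graph $\vec{G}$ is a homomorphism from $\vec{G}$ to some orientation $\vec{K}_k$ of the complete graph $K_k$ (a tournament on $k$ vertices), i.e. a function $\phi: V(\vec{G}) \to V(\vec{K}_k)$ such that $(u,v)\in A(\vec{G})$ implies $(\phi(u),\phi(v))\in A(\vec{K}_k)$. The oriented chromatic number $\chi_o(\vec{G})$ of an oriented graph $\vec{G}$ is the minimum $k$ for which $\vec{G}$ has an oriented $k$-coloring. The oriented chromatic number $\chi_o(G)$ of an unoriented graph $G$ is the maximum of $\chi_o(\vec{G})$ over all orientations $\vec{G}$ of $G$. For a family $\mathcal{F}$ of graphs, $\chi_o(\mathcal{F}) = \max\{\chi_o(G) \mid G\in\mathcal{F}\}$. The square grid $S(m,n)$ is the graph with vertices $v_{i,j}$, $1\le i\le m$, $1\le j\le n$, whose edges are all pairs $\{v_{i,j},v_{i,j+1}\}$ and $\{v_{i,j},v_{i+1,j}\}$ with both endpoints in the vertex set. The hexagonal grid $H_{m,n}$ ($m$ rows of $n$ hexagons) is the subgraph of $S(m+1,2n+m)$ whose vertices are exactly the vertices $v_{i,j}$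 of $S(m+1,2n+m)$ satisfying $i-1\le j\le i+2n$, and whose edges are all edges $\{v_{i,j},v_{i,j+1}\}$ between such vertices, together with the edges $\{v_{i,j},v_{i+1,j}\}$ between such vertices for which $i+j$ is even. $\mathcal{H}_2$ denotes the set of all (not necessarily induced) subgraphs of $H_{m,n}$, for all positive integers $m$ and $n$. *)

theory Defs
  imports "Graph_Theory.Digraph_Component" "HOL-Library.Extended_Nat"
begin

text \<open>
  Finite simple graphs are the symmetric, loop-free, finite digraphs
  \<open>pair_graph\<close> of the Graph Theory library: an edge between \<open>u\<close> and \<open>v\<close> is the
  pair of arcs \<open>(u, v)\<close>, \<open>(v, u)\<close>.
\<close>

definition is_orientation :: "'a pair_pre_digraph \<Rightarrow> 'a pair_pre_digraph \<Rightarrow> bool" where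
  "is_orientation D G \<longleftrightarrow>
     pverts D = pverts G \<and> parcs D \<subseteq> parcs G \<and>
     (\<forall>(u, v) \<in> parcs G. (u, v) \<in> parcs D \<longleftrightarrow> (v, u) \<notin> parcs D)"

definition is_digraph_hom ::
    "('a \<Rightarrow> 'b) \<Rightarrow> 'a pair_pre_digraph \<Rightarrow> 'b pair_pre_digraph \<Rightarrow> bool" where
  "is_digraph_hom \<phi> D T \<longleftrightarrow>
     \<phi> ` pverts D \<subseteq> pverts T \<and> (\<forall>(u, v) \<in> parcs D. (\<phi> u, \<phi> v) \<in> parcs T)"

definition complete_graph :: "nat \<Rightarrow> nat pair_pre_digraph" where
  "complete_graph k =
     \<lparr> pverts = {..<k}, parcs = {(u, v). u < k \<and> v < k \<and> u \<noteq> v} \<rparr>"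

definition oriented_coloring :: "'a pair_pre_digraph \<Rightarrow> nat \<Rightarrow> ('a \<Rightarrow> nat) \<Rightarrow> bool" where
  "oriented_coloring D k \<phi> \<longleftrightarrow>
     (\<exists>T. is_orientation T (complete_graph k) \<and> is_digraph_hom \<phi> D T)"

definition oriented_chromatic_number_digraph :: "'a pair_pre_digraph \<Rightarrow> nat" where
  "oriented_chromatic_number_digraph D = (LEAST k. \<exists>\<phi>. oriented_coloring D k \<phi>)"

definition oriented_chromatic_number :: "'a pair_pre_digraph \<Rightarrow> nat" where
  "oriented_chromatic_number G =
     Max {oriented_chromatic_number_digraph D | D. is_orientation D G}"

text \<open>
  The family may be infinite, so the maximum over it is taken as a supremum in
  \<^typ>\<open>enat\<close>: it is the maximum when the values are bounded (see
  \<open>oriented_chromatic_number_family_eq_Max\<close>) and \<open>\<infinity>\<close> otherwise.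
\<close>

definition oriented_chromatic_number_family :: "'a pair_pre_digraph set \<Rightarrow> enat" where
  "oriented_chromatic_number_family F = (SUP G\<in>F. enat (oriented_chromatic_number G))"

definition square_grid :: "nat \<Rightarrow> nat \<Rightarrow> (nat \<times> nat) pair_pre_digraph" where
  "square_grid m n =
     (let V = {1..m} \<times> {1..n} in
      mk_symmetric (with_proj
        \<lparr> pverts = V,
          parcs = {(u, v) \<in> V \<times> V. \<exists>i j. u = (i, j) \<and> (v = (i, j + 1) \<or> v = (i + 1, j))} \<rparr>))"

text \<open>The condition \<open>i \<le> j + 1\<close> is \<open>i - 1 \<le> j\<close> without truncated subtraction.\<close>

definition hex_grid :: "nat \<Rightarrow> nat \<Rightarrow> (nat \<times> nat) pair_pre_digraph" where
  "hex_grid m n =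
     (let V = {(i, j) \<in> pverts (square_grid (m + 1) (2 * n + m)). i \<le> j + 1 \<and> j \<le> i + 2 * n} in
      mk_symmetric (with_proj
        \<lparr> pverts = V,
          parcs = {(u, v) \<in> V \<times> V. \<exists>i j. u = (i, j) \<and>
                     (v = (i, j + 1) \<or> v = (i + 1, j) \<and> even (i + j))} \<rparr>))"

definition hex_subgraphs :: "(nat \<times> nat) pair_pre_digraph set" where
  "hex_subgraphs =
     {H. pair_graph H \<and>
         (\<exists>m n. 1 \<le> m \<and> 1 \<le> n \<and> subgraph (with_proj H) (with_proj (hex_grid m n)))}"

lemma finite_orientations:
  assumes "pair_graph G"
  shows "finite {D. is_orientation D G}"
proof -
  interpret pair_graph G by fact
  have "{D. is_orientation D G} \<subseteq> (\<lambda>A. \<lparr>pverts = pverts G, parcs = A\<rparr>) ` Pow (parcs G)"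
  proof
    fix D assume "D \<in> {D. is_orientation D G}"
    then have "D = \<lparr>pverts = pverts G, parcs = parcs D\<rparr>" "parcs D \<in> Pow (parcs G)"
      by (auto simp: is_orientation_def)
    then show "D \<in> (\<lambda>A. \<lparr>pverts = pverts G, parcs = A\<rparr>) ` Pow (parcs G)"
      by (rule image_eqI)
  qed
  then show ?thesis
    using pair_finite_arcs by (meson finite_Pow_iff finite_imageI finite_subset)
qed

lemma oriented_chromatic_number_family_eq_Max:
  assumes "finite (oriented_chromatic_number ` F)" "F \<noteq> {}"
  shows "oriented_chromatic_number_family F = enat (Max (oriented_chromatic_number ` F))"
proof -
  have "enat (Max (oriented_chromatic_number ` F)) = Max (enat ` oriented_chromatic_number ` F)"
    using assms by (intro mono_Max_commute) (auto simp: mono_def)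
  then show ?thesis
    using assms finite_imageI[OF assms(1), of enat]
    by (simp add: oriented_chromatic_number_family_def image_image Max_Sup[symmetric] cSup_eq_Max)
qed

lemma mk_symmetric_with_proj_iff:
  "(u, v) \<in> parcs (mk_symmetric (with_proj D)) \<longleftrightarrow> (u, v) \<in> parcs D \<or> (v, u) \<in> parcs D"
  by (auto simp: mk_symmetric_def intro: bexI[of _ "(u, v)"] bexI[of _ "(v, u)"])

lemma hex_grid_subgraph_square_grid:
  "subgraph (with_proj (hex_grid m n)) (with_proj (square_grid (m + 1) (2 * n + m)))"
proof -
  let ?H = "hex_grid m n" and ?S = "square_grid (m + 1) (2 * n + m)"
  have verts: "pverts ?H \<subseteq> pverts ?S"
    by (auto simp: hex_grid_def Let_def mk_symmetric_def)
  have "(u, v) \<in> parcs ?S" if "(u, v) \<in> parcs ?H" for u v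
    using that
    by (auto simp: hex_grid_def square_grid_def Let_def mk_symmetric_with_proj_iff)
  moreover have "pair_wf_digraph ?H" "pair_wf_digraph ?S"
    by unfold_locales
      (auto simp: hex_grid_def square_grid_def Let_def mk_symmetric_def)
  ultimately show ?thesis
    using verts unfolding subgraph_def wf_digraph_wp_iff
    by (auto simp: compatible_def)
qed

lemma pair_graph_hex_grid: "pair_graph (hex_grid m n)"
proof -
  have "finite (pverts (hex_grid m n))"
    by (rule finite_subset[of _ "{1..m + 1} \<times> {1..2 * n + m}"])
      (auto simp: hex_grid_def square_grid_def Let_def mk_symmetric_def)
  moreover have "parcs (hex_grid m n) \<subseteq> pverts (hex_grid m n) \<times> pverts (hex_grid m n)"
    by (auto simp: hex_grid_def Let_def mk_symmetric_def)
  moreover from calculation have "finite (parcs (hex_grid m n))"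
    by (meson finite_SigmaI finite_subset)
  moreover have "sym (parcs (hex_grid m n))"
    by (auto simp: hex_grid_def Let_def mk_symmetric_def sym_def)
  moreover have "\<forall>(u, v) \<in> parcs (hex_grid m n). u \<noteq> v"
    by (auto simp: hex_grid_def Let_def mk_symmetric_def)
  ultimately show ?thesis
    by unfold_locales (auto simp: symmetric_def)
qed

end

theory Submission
  imports Defs
begin

text \<open>
  A piece of four rows of a hexagonal grid is a brick wall.  Numbering its vertices column by column
  as \<open>0, 1, 2, \<dots>\<close>, every edge joins \<open>k + 4\<close> to \<open>k\<close> (same row) or to \<open>k + 3\<close> (same column).  Hence the
  colors of four consecutive vertices are all that matters for extending a homomorphism into a fixed
  tournament to the next vertex, and the set of realisable 4-tuples of colors can be computed vertex
  by vertex.  For a suitable orientation of 23 columns, found by a beam search that minimises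
  the number of realisable tuples, this set becomes empty for every tournament on five
  vertices.  By Redei's theorem every such tournament has a Hamiltonian path, which fixes four arcs
  and leaves only 64 tournaments to run through.
\<close>

section \<open>Oriented colorings\<close>

text \<open>Tournaments become asymmetric total relations, the form used to build them and to apply
  Redei's theorem.\<close>

lemma is_orientation_complete_graph_iff:
  "is_orientation T (complete_graph k) \<longleftrightarrow>
     pverts T = {..<k} \<and> parcs T \<subseteq> {..<k} \<times> {..<k} \<and> asym (parcs T) \<and>
     total_on {..<k} (parcs T)"
  (is "?L \<longleftrightarrow> ?R")
proof
  assume L: ?L
  have ori: "(u, v) \<in> parcs T \<longleftrightarrow> (v, u) \<notin> parcs T" if "u < k" "v < k" "u \<noteq> v" for u v
  proof -
    have "(u, v) \<in> parcs (complete_graph k)"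
      using that by (simp add: complete_graph_def)
    with L show ?thesis
      unfolding is_orientation_def by blast
  qed
  have "pverts T = pverts (complete_graph k)" "parcs T \<subseteq> parcs (complete_graph k)"
    using L unfolding is_orientation_def by blast+
  then have verts: "pverts T = {..<k}" and sub: "parcs T \<subseteq> {(u, v). u < k \<and> v < k \<and> u \<noteq> v}"
    by (simp_all add: complete_graph_def)
  have "asym (parcs T)"
  proof (rule asymI)
    fix u v assume "(u, v) \<in> parcs T"
    then show "(v, u) \<notin> parcs T"
      using sub ori[of u v] by blast
  qed
  moreover have "total_on {..<k} (parcs T)"
  proof (rule total_onI)
    fix u v assume "u \<in> {..<k}" "v \<in> {..<k}" "u \<noteq> v"
    then show "(u, v) \<in> parcs T \<or> (v, u) \<in> parcs T"
      using ori[of u v] by simp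
  qed
  ultimately show ?R
    using verts sub by blast
next
  assume R: ?R
  have "(u, v) \<in> parcs T \<longleftrightarrow> (v, u) \<notin> parcs T" if "u < k" "v < k" "u \<noteq> v" for u v
  proof -
    have "(u, v) \<in> parcs T \<or> (v, u) \<in> parcs T"
      using R that by (simp add: total_on_def)
    moreover have "\<not> ((u, v) \<in> parcs T \<and> (v, u) \<in> parcs T)"
      using R asymD[of "parcs T" u v] by blast
    ultimately show ?thesis
      by blast
  qed
  then have "\<forall>(u, v) \<in> parcs (complete_graph k). (u, v) \<in> parcs T \<longleftrightarrow> (v, u) \<notin> parcs T"
    unfolding complete_graph_def pair_pre_digraph.simps by fast
  moreover have "parcs T \<subseteq> parcs (complete_graph k)"
  proof
    fix e assume "e \<in> parcs T"
    then show "e \<in> parcs (complete_graph k)"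
      using R asymD[of "parcs T" "fst e" "snd e"] by (cases e) (auto simp: complete_graph_def)
  qed
  moreover have "pverts T = pverts (complete_graph k)"
    using R by (simp add: complete_graph_def)
  ultimately show ?L
    unfolding is_orientation_def by (intro conjI)
qed

text \<open>The tournament can be enlarged. Hence excluding five colors excludes every smaller
  number too, as the \<open>LEAST\<close> in the chromatic number demands.\<close>

lemma oriented_coloring_mono:
  assumes "oriented_coloring D k \<phi>" "k \<le> k'"
  shows "oriented_coloring D k' \<phi>"
proof -
  obtain T where T: "is_orientation T (complete_graph k)" "is_digraph_hom \<phi> D T"
    using assms(1) by (auto simp: oriented_coloring_def)
  \<comment> \<open>Each new vertex receives an arc from every smaller vertex; arcs between old
    vertices stay as they are.\<close>
  let ?A = "parcs T \<union> {(u, v). u < v \<and> k \<le> v \<and> v < k'}"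
  let ?T = "\<lparr>pverts = {..<k'}, parcs = ?A\<rparr>"
  have T': "pverts T = {..<k}" "parcs T \<subseteq> {..<k} \<times> {..<k}" "asym (parcs T)"
    "total_on {..<k} (parcs T)"
    using T(1) by (simp_all add: is_orientation_complete_graph_iff)
  have "?A \<subseteq> {..<k'} \<times> {..<k'}"
    using T'(2) assms(2) by force
  moreover have "asym ?A"
  proof (rule asymI)
    fix u v assume "(u, v) \<in> ?A"
    then show "(v, u) \<notin> ?A"
      using T'(2) asymD[OF T'(3)] by fastforce
  qed
  moreover have "total_on {..<k'} ?A"
  proof (rule total_onI)
    fix u v assume uv: "u \<in> {..<k'}" "v \<in> {..<k'}" "u \<noteq> v"
    show "(u, v) \<in> ?A \<or> (v, u) \<in> ?A"
    proof (cases "u < k \<and> v < k")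
      case True
      then show ?thesis
        using T'(4) uv(3) by (simp add: total_on_def)
    next
      case False
      then show ?thesis
        using uv by auto
    qed
  qed
  ultimately have "is_orientation ?T (complete_graph k')"
    by (simp add: is_orientation_complete_graph_iff)
  moreover have "is_digraph_hom \<phi> D ?T"
    using T(2) T'(1) assms(2) by (fastforce simp: is_digraph_hom_def)
  ultimately show ?thesis
    by (auto simp: oriented_coloring_def)
qed

text \<open>Giving all vertices different colors works, so the \<open>LEAST\<close> in the chromatic
  number is attained.\<close>

lemma ex_oriented_coloring:
  assumes "pair_graph G" "is_orientation D G"
  shows "\<exists>k \<phi>. oriented_coloring D k \<phi>"
proof -
  interpret pair_graph G by fact
  let ?k = "card (pverts G)"
  obtain f :: "'a \<Rightarrow> nat" where f: "inj_on f (pverts G)" "f ` pverts G = {..<?k}"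
    using ex_bij_betw_finite_nat[OF pair_finite_verts]
    by (auto simp: bij_betw_def atLeast0LessThan)
  let ?A = "{(f u, f v) | u v. (u, v) \<in> parcs D}"
  \<comment> \<open>\<open>?A\<close> carries over the arcs of \<open>D\<close>; pairs it leaves
    open are directed upwards.\<close>
  let ?B = "?A \<union> {(x, y). x < y \<and> y < ?k \<and> (y, x) \<notin> ?A}"
  let ?T = "\<lparr>pverts = {..<?k}, parcs = ?B\<rparr>"
  have D: "pverts D = pverts G" "parcs D \<subseteq> parcs G"
    "\<And>u v. (u, v) \<in> parcs D \<Longrightarrow> (v, u) \<notin> parcs D"
    using assms(2) unfolding is_orientation_def by blast+
  have verts: "u \<in> pverts G" "v \<in> pverts G" if "(u, v) \<in> parcs D" for u v
    using that D(2) in_arcsD1 in_arcsD2 by blast+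
  have lt: "f u < ?k" if "u \<in> pverts G" for u
    using f(2) that by blast
  have asym: "(y, x) \<notin> ?A" if xy: "(x, y) \<in> ?A" for x y
  proof
    assume "(y, x) \<in> ?A"
    then obtain u v u' v' where uv: "(u, v) \<in> parcs D" "(u', v') \<in> parcs D"
      "x = f u" "y = f v" "y = f u'" "x = f v'"
      using xy by blast
    then have "u' = v" "v' = u"
      using f(1) verts[OF uv(1)] verts[OF uv(2)] by (simp_all add: inj_on_def)
    then show False
      using uv D(3) by blast
  qed
  have "?A \<subseteq> {..<?k} \<times> {..<?k}"
    using verts lt by blast
  then have "?B \<subseteq> {..<?k} \<times> {..<?k}"
    by auto
  moreover have "asym ?B"
  proof (rule asymI)
    fix x y assume "(x, y) \<in> ?B"
    then show "(y, x) \<notin> ?B"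
      using asym[of x y] by (cases "(x, y) \<in> ?A") auto
  qed
  moreover have "total_on {..<?k} ?B"
  proof (rule total_onI)
    fix x y assume "x \<in> {..<?k}" "y \<in> {..<?k}" "x \<noteq> y"
    then show "(x, y) \<in> ?B \<or> (y, x) \<in> ?B"
      by (cases "x < y") auto
  qed
  ultimately have "is_orientation ?T (complete_graph ?k)"
    by (simp add: is_orientation_complete_graph_iff)
  moreover have "is_digraph_hom f D ?T"
    using D(1) lt by (auto simp: is_digraph_hom_def)
  ultimately show ?thesis
    by (auto simp: oriented_coloring_def)
qed

lemma oriented_chromatic_number_gtI:
  assumes "pair_graph G" "is_orientation D G" "\<And>\<phi>. \<not> oriented_coloring D k \<phi>"
  shows "oriented_chromatic_number G > k"
proof -
  let ?n = "oriented_chromatic_number_digraph D"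
  have "\<exists>\<phi>. oriented_coloring D ?n \<phi>"
    unfolding oriented_chromatic_number_digraph_def
    using ex_oriented_coloring[OF assms(1,2)] by (rule LeastI_ex)
  then have "k < ?n"
    using assms(3) oriented_coloring_mono not_le by blast
  also have "?n \<le> oriented_chromatic_number G"
    unfolding oriented_chromatic_number_def
    using finite_orientations[OF assms(1)] assms(2) by (intro Max_ge) auto
  finally show ?thesis .
qed

text \<open>The new vertex \<open>a\<close> is inserted before the first vertex of the path that has
  no arc to \<open>a\<close>; the hypothesis then supplies the arc from \<open>a\<close> to that
  vertex.\<close>

lemma redei:
  assumes "finite A" "\<And>x y. x \<in> A \<Longrightarrow> y \<in> A \<Longrightarrow> x \<noteq> y \<Longrightarrow> E x y \<or> E y x"
  shows "\<exists>xs. set xs = A \<and> distinct xs \<and> successively E xs"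
  using assms
proof (induction A rule: finite_induct)
  case (insert a A)
  then obtain xs where xs: "set xs = A" "distinct xs" "successively E xs"
    by auto
  define ys zs where "ys = takeWhile (\<lambda>x. E x a) xs" and "zs = dropWhile (\<lambda>x. E x a) xs"
  have eq: "xs = ys @ zs"
    by (simp add: ys_def zs_def)
  have "E (last ys) a" if "ys \<noteq> []"
    using that last_in_set[OF that] set_takeWhileD unfolding ys_def by fast
  moreover have "E a (hd zs)" if "zs \<noteq> []"
  proof -
    have "\<not> E (hd zs) a"
      using that hd_dropWhile unfolding zs_def by blast
    moreover have "hd zs \<in> A"
      using that xs(1) eq by auto
    ultimately show ?thesis
      using insert.prems[of a "hd zs"] insert.hyps(2) by auto
  qed
  moreover have "successively E ys" "successively E zs"
    using xs(3) unfolding eq successively_append_iff by auto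
  ultimately have "successively E (ys @ a # zs)"
    by (auto simp: successively_append_iff successively_Cons)
  then show ?case
    using xs insert.hyps(2) eq by (intro exI[of _ "ys @ a # zs"]) auto
qed simp

section \<open>Sets of color words\<close>

datatype color = C0 | C1 | C2 | C3 | C4

text \<open>Encodes maps on the five colors as constructor terms, on which evaluation by rewriting
  can match.\<close>

datatype 'a five = Five 'a 'a 'a 'a 'a

fun entry :: "'a five \<Rightarrow> color \<Rightarrow> 'a" where
  "entry (Five a b c d e) C0 = a"
| "entry (Five a b c d e) C1 = b"
| "entry (Five a b c d e) C2 = c"
| "entry (Five a b c d e) C3 = d"
| "entry (Five a b c d e) C4 = e"

definition table :: "(color \<Rightarrow> 'a) \<Rightarrow> 'a five" where
  "table f = Five (f C0) (f C1) (f C2) (f C3) (f C4)"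

text \<open>\<open>Full\<close> is the set of all words of any length, and \<open>Node\<close> never contains the empty word.\<close>

datatype trie = Empty | Full | Node "trie five"

fun children :: "trie \<Rightarrow> trie five" where
  "children Empty = Five Empty Empty Empty Empty Empty"
| "children Full = Five Full Full Full Full Full"
| "children (Node f) = f"

fun mem :: "color list \<Rightarrow> trie \<Rightarrow> bool" where
  "mem [] t \<longleftrightarrow> t = Full"
| "mem (x # xs) t \<longleftrightarrow> mem xs (entry (children t) x)"

text \<open>Keeps the empty set in the form \<open>Empty\<close>, so that a comparison with
  \<open>Empty\<close> detects it.\<close>

fun node :: "trie five \<Rightarrow> trie" where
  "node (Five Empty Empty Empty Empty Empty) = Empty"
| "node f = Node f"

fun join :: "trie \<Rightarrow> trie \<Rightarrow> trie" where
  "join Empty t = t"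
| "join Full t = Full"
| "join (Node f) Empty = Node f"
| "join (Node f) Full = Full"
| "join (Node (Five a b c d e)) (Node (Five a' b' c' d' e')) =
     Node (Five (join a a') (join b b') (join c c') (join d d') (join e e'))"

fun meet :: "trie \<Rightarrow> trie \<Rightarrow> trie" where
  "meet Empty t = Empty"
| "meet Full t = t"
| "meet (Node f) Empty = Empty"
| "meet (Node f) Full = Node f"
| "meet (Node (Five a b c d e)) (Node (Five a' b' c' d' e')) =
     node (Five (meet a a') (meet b b') (meet c c') (meet d d') (meet e e'))"

text \<open>
  Appends to the words of length \<open>n\<close> in the trie all colors allowed both by \<open>p\<close> and by the entry of
  the table that belongs to their last letter; \<open>q\<close> is the entry of the letter read last.
\<close>

fun append_allowed :: "nat \<Rightarrow> trie \<Rightarrow> trie five \<Rightarrow> trie \<Rightarrow> trie \<Rightarrow> trie" where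
  "append_allowed n p V q Empty = Empty"
| "append_allowed 0 p V q Full = meet p q"
| "append_allowed 0 p V q (Node f) = Empty"
| "append_allowed (Suc n) p (Five v0 v1 v2 v3 v4) q Full =
     node (Five (append_allowed n p (Five v0 v1 v2 v3 v4) v0 Full)
                (append_allowed n p (Five v0 v1 v2 v3 v4) v1 Full)
                (append_allowed n p (Five v0 v1 v2 v3 v4) v2 Full)
                (append_allowed n p (Five v0 v1 v2 v3 v4) v3 Full)
                (append_allowed n p (Five v0 v1 v2 v3 v4) v4 Full))"
| "append_allowed (Suc n) p (Five v0 v1 v2 v3 v4) q (Node (Five a b c d e)) =
     node (Five (append_allowed n p (Five v0 v1 v2 v3 v4) v0 a)
                (append_allowed n p (Five v0 v1 v2 v3 v4) v1 b)
                (append_allowed n p (Five v0 v1 v2 v3 v4) v2 c)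
                (append_allowed n p (Five v0 v1 v2 v3 v4) v3 d)
                (append_allowed n p (Five v0 v1 v2 v3 v4) v4 e))"

text \<open>Slides the window by one vertex. The words are split by the letter being dropped, since
  its row restricts the new color. The initial \<open>Full\<close> for \<open>q\<close> is replaced
  once a letter is read.\<close>

fun shift :: "trie five \<Rightarrow> trie five \<Rightarrow> trie \<Rightarrow> trie" where
  "shift (Five h0 h1 h2 h3 h4) V t = (case children t of Five a b c d e \<Rightarrow>
     join (join (append_allowed (Suc (Suc (Suc 0))) h0 V Full a)
                (append_allowed (Suc (Suc (Suc 0))) h1 V Full b))
          (join (join (append_allowed (Suc (Suc (Suc 0))) h2 V Full c)
                      (append_allowed (Suc (Suc (Suc 0))) h3 V Full d))
                (append_allowed (Suc (Suc (Suc 0))) h4 V Full e)))"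

section \<open>Correctness of the trie operations\<close>

lemma mem_Empty [simp]: "\<not> mem xs Empty"
proof (induction xs)
  case (Cons x xs)
  then show ?case by (cases x) simp_all
qed simp

lemma mem_Full [simp]: "mem xs Full"
proof (induction xs)
  case (Cons x xs)
  then show ?case by (cases x) simp_all
qed simp

lemma mem_node: "mem xs (node f) \<longleftrightarrow> mem xs (Node f)"
proof (cases f rule: node.cases)
  case 1
  then show ?thesis
    by (cases xs; cases "hd xs") simp_all
qed simp_all

lemma mem_Node_Five:
  "mem (x # xs) (Node (Five a b c d e)) \<longleftrightarrow>
     (case x of C0 \<Rightarrow> mem xs a | C1 \<Rightarrow> mem xs b | C2 \<Rightarrow> mem xs c | C3 \<Rightarrow> mem xs d | C4 \<Rightarrow> mem xs e)"
  by (cases x) simp_all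

lemma mem_join: "mem xs (join s t) \<longleftrightarrow> mem xs s \<or> mem xs t"
proof (induction s t arbitrary: xs rule: join.induct)
  case (5 a b c d e a' b' c' d' e')
  then show ?case
    by (cases xs) (simp_all add: mem_Node_Five del: mem.simps(2) split: color.split)
qed simp_all

lemma mem_meet: "mem xs (meet s t) \<longleftrightarrow> mem xs s \<and> mem xs t"
proof (induction s t arbitrary: xs rule: meet.induct)
  case (5 a b c d e a' b' c' d' e')
  then show ?case
    by (cases xs) (simp_all add: mem_node mem_Node_Five del: mem.simps(2) split: color.split)
qed simp_all

text \<open>In the induction \<open>q\<close> takes over the role of the last letter when the
  remaining word is empty. One inclusion suffices, because the computed set is to be shown
  empty.\<close>

lemma mem_append_allowed:
  assumes "mem xs t" "length xs = n" "mem [y] p" "mem [y] (if xs = [] then q else entry V (last xs))"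
  shows "mem (xs @ [y]) (append_allowed n p V q t)"
  using assms
proof (induction n p V q t arbitrary: xs rule: append_allowed.induct)
  case (2 p V q)
  then show ?case by (simp add: mem_meet del: mem.simps(2))
next
  case (4 n p v0 v1 v2 v3 v4 q)
  then obtain x ys where "xs = x # ys" "length ys = n"
    by (auto simp: length_Suc_conv)
  then show ?case
    using 4 by (cases x) (simp_all add: mem_node split: if_splits)
next
  case (5 n p v0 v1 v2 v3 v4 q a b c d e)
  then obtain x ys where "xs = x # ys" "length ys = n"
    by (auto simp: length_Suc_conv)
  then show ?case
    using 5 by (cases x) (simp_all add: mem_node split: if_splits)
qed simp_all

lemma mem_shift:
  assumes "mem (x # xs) t" "length xs = 3" "mem [y] (entry H x)" "mem [y] (entry V (last xs))"
  shows "mem (xs @ [y]) (shift H V t)"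
proof -
  have "mem (xs @ [y]) (append_allowed (Suc (Suc (Suc 0))) (entry H x) V Full (entry (children t) x))"
    using assms by (intro mem_append_allowed) (auto simp: numeral_3_eq_3)
  then show ?thesis
    by (cases H; cases "children t"; cases x) (simp_all add: mem_join)
qed

section \<open>Homomorphisms of oriented brick walls\<close>

datatype direction = N | F | B

fun orient :: "direction \<Rightarrow> nat \<Rightarrow> nat \<Rightarrow> (nat \<times> nat) set" where
  "orient N x y = {}"
| "orient F x y = {(x, y)}"
| "orient B x y = {(y, x)}"

text \<open>The pair \<open>(h, v)\<close> at position \<open>k\<close> directs the edges that join vertex \<open>k + 4\<close> to \<open>k\<close> and \<open>k + 3\<close>.\<close>

definition wall_arcs :: "(direction \<times> direction) list \<Rightarrow> (nat \<times> nat) set" where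
  "wall_arcs ws =
     (\<Union>k<length ws. orient (fst (ws ! k)) k (k + 4) \<union> orient (snd (ws ! k)) (k + 3) (k + 4))"

fun row :: "bool five \<Rightarrow> trie" where
  "row (Five a b c d e) =
     node (Five (if a then Full else Empty) (if b then Full else Empty) (if c then Full else Empty)
       (if d then Full else Empty) (if e then Full else Empty))"

fun rows :: "bool five five \<Rightarrow> trie five" where
  "rows (Five a b c d e) = Five (row a) (row b) (row c) (row d) (row e)"

text \<open>A missing edge restricts nothing, hence \<open>Full\<close>. \<open>M'\<close> is meant
  to be the converse of \<open>M\<close>, which serves reversed arcs.\<close>

fun select :: "trie five \<Rightarrow> trie five \<Rightarrow> direction \<Rightarrow> trie five" where
  "select M M' N = Five Full Full Full Full Full"
| "select M M' F = M"
| "select M M' B = M'"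

fun run :: "trie five \<Rightarrow> trie five \<Rightarrow> trie \<Rightarrow> (direction \<times> direction) list \<Rightarrow> trie" where
  "run M M' Empty ws = Empty"
| "run M M' t [] = t"
| "run M M' t ((h, v) # ws) = run M M' (shift (select M M' h) (select M M' v) t) ws"

lemma run_Cons: "run M M' t ((h, v) # ws) =
    (if t = Empty then Empty else run M M' (shift (select M M' h) (select M M' v) t) ws)"
  by (cases t) simp_all

lemma mem_rows:
  "mem [y] (entry (rows (table (\<lambda>x. table (R x)))) x) \<longleftrightarrow> R x y"
  by (cases x; cases y) (simp_all add: table_def mem_node del: node.simps)

definition realisable :: "(color \<Rightarrow> color \<Rightarrow> bool) \<Rightarrow> trie \<Rightarrow> (direction \<times> direction) list \<Rightarrow> trie" where
  "realisable R = run (rows (table (\<lambda>x. table (R x)))) (rows (table (\<lambda>x. table (\<lambda>y. R y x))))"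

lemma mem_select:
  assumes "\<And>x y. (x, y) \<in> orient d i j \<Longrightarrow> R (c x) (c y)"
  shows "mem [c j] (entry (select (rows (table (\<lambda>x. table (R x))))
    (rows (table (\<lambda>x. table (\<lambda>y. R y x)))) d) (c i))"
proof (cases d)
  case N
  then show ?thesis by (cases "c i") simp_all
qed (use assms in \<open>simp_all add: mem_rows mem_rows[of _ "\<lambda>x y. R y x"] del: mem.simps\<close>)

text \<open>Invariant: the trie contains the colors that \<open>c\<close> gives to the current four
  consecutive vertices, so it never becomes empty.\<close>

lemma mem_realisable:
  assumes "\<And>x y. (x, y) \<in> wall_arcs ws \<Longrightarrow> R (c x) (c y)" "mem [c 0, c 1, c 2, c 3] t"
  shows "realisable R t ws \<noteq> Empty"
  using assms
proof (induction ws arbitrary: c t)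
  case Nil
  then show ?case by (cases t) (auto simp: realisable_def simp del: mem.simps)
next
  case (Cons w ws)
  obtain h v where w: "w = (h, v)" by (cases w)
  let ?s = "select (rows (table (\<lambda>x. table (R x)))) (rows (table (\<lambda>x. table (\<lambda>y. R y x))))"
  have arcs: "orient h 0 4 \<union> orient v 3 4 \<subseteq> wall_arcs (w # ws)"
    using w by (force simp: wall_arcs_def)
  \<comment> \<open>Dropping vertex 0 and renumbering turns the rest into the wall of
    \<open>ws\<close>; the induction hypothesis is then used for the shifted coloring.\<close>
  have "(Suc x, Suc y) \<in> wall_arcs (w # ws)" if "(x, y) \<in> wall_arcs ws" for x y
  proof -
    obtain k where k: "k < length ws"
      "(x, y) \<in> orient (fst (ws ! k)) k (k + 4) \<union> orient (snd (ws ! k)) (k + 3) (k + 4)"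
      using \<open>(x, y) \<in> wall_arcs ws\<close> by (auto simp: wall_arcs_def)
    have "(Suc x, Suc y) \<in> orient d (Suc i) (Suc j)" if "(x, y) \<in> orient d i j" for d i j
      using that by (cases d) auto
    then show ?thesis
      using k unfolding wall_arcs_def by (intro UN_I[of "Suc k"]) force+
  qed
  then have "R (c (Suc x)) (c (Suc y))" if "(x, y) \<in> wall_arcs ws" for x y
    using Cons.prems(1) that by blast
  moreover have "mem ([c 1, c 2, c 3] @ [c 4]) (shift (?s h) (?s v) t)"
    using Cons.prems arcs
    by (intro mem_shift[of "c 0"]) (auto intro!: mem_select simp del: mem.simps)
  ultimately have "realisable R (shift (?s h) (?s v) t) ws \<noteq> Empty"
    using Cons.IH[of "\<lambda>k. c (Suc k)"] by (simp add: numeral_eq_Suc del: mem.simps)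
  moreover have "t \<noteq> Empty"
    using Cons.prems(2) by (auto simp del: mem.simps)
  ultimately show ?case
    by (simp add: w run_Cons realisable_def)
qed

text \<open>
  The vertices \<open>0, \<dots>, 3\<close> are isolated, so that the computation may start with all words; \<open>N\<close> in the
  second component also marks the positions where the brick wall has no edge.
\<close>

definition the_wall :: "(direction \<times> direction) list" where
  "the_wall =
    [(N,N), (N,F), (N,N), (N,F), (B,N), (F,N), (B,F), (B,N),
     (B,N), (F,B), (B,N), (B,B), (B,N), (B,N), (F,B), (B,N),
     (B,N), (F,B), (B,N), (B,B), (B,N), (B,N), (B,B), (B,N),
     (B,N), (B,F), (B,N), (B,F), (F,N), (F,N), (B,B), (B,N),
     (B,N), (F,F), (B,N), (F,F), (B,N), (F,N), (B,B), (F,N),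
     (B,N), (F,B), (B,N), (F,B), (B,N), (B,N), (B,F), (F,N),
     (F,N), (B,F), (B,N), (B,B), (F,N), (F,N), (F,B), (B,N),
     (B,N), (F,F), (F,N), (F,B), (B,N), (F,N), (F,F), (B,N),
     (B,N), (B,F), (B,N), (B,B), (B,N), (F,N), (B,F), (B,N),
     (F,N), (F,F), (F,N), (B,B), (F,N), (F,N), (F,B), (B,N),
     (F,N), (F,B), (F,N), (F,F), (F,N), (B,N), (F,B), (B,N),
     (F,N), (B,B)]"

text \<open>
  The two matrices are the adjacency matrices of a tournament with Hamiltonian path
  \<open>C0, C1, C2, C3, C4\<close> and of its converse.
\<close>

fun killed :: "bool list \<Rightarrow> bool" where
  "killed [b02, b03, b04, b13, b14, b24] \<longleftrightarrow> run
     (rows (Five (Five False True b02 b03 b04)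
           (Five False False True b13 b14)
           (Five (\<not> b02) False False True b24)
           (Five (\<not> b03) (\<not> b13) False False True)
           (Five (\<not> b04) (\<not> b14) (\<not> b24) False False)))
     (rows (Five (Five False False (\<not> b02) (\<not> b03) (\<not> b04))
           (Five True False False (\<not> b13) (\<not> b14))
           (Five b02 True False False (\<not> b24))
           (Five b03 b13 True False False)
           (Five b04 b14 b24 True False)))
     Full the_wall = Empty"
| "killed _ \<longleftrightarrow> True"

text \<open>The six Booleans are the arcs, out of ten, that the Hamiltonian path leaves
  open.\<close>

lemma killed_all: "list_all killed (List.n_lists 6 [True, False])"
  by code_simp

section \<open>The brick wall as a part of a hexagonal grid\<close>

text \<open>
  The offset \<open>4\<close> keeps the wall to the right of the slanted boundary \<open>i - 1 \<le> j\<close>; its parity matches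
  the positions of the vertical edges.
\<close>

definition place :: "nat \<Rightarrow> nat \<times> nat" where
  "place k = (k mod 4 + 1, k div 4 + 4)"

definition wall_orientation :: "(nat \<times> nat) pair_pre_digraph" where
  "wall_orientation =
     \<lparr> pverts = place ` {..<length the_wall + 4}, parcs = map_prod place place ` wall_arcs the_wall \<rparr>"

definition wall_graph :: "(nat \<times> nat) pair_pre_digraph" where
  "wall_graph =
     \<lparr> pverts = pverts wall_orientation,
       parcs = parcs wall_orientation \<union> (parcs wall_orientation)\<inverse> \<rparr>"

lemma length_the_wall: "length the_wall = 90"
  by (simp add: the_wall_def)

text \<open>Checked entry by entry. \<open>k mod 4 = 0\<close> would join the end of one column to
  the start of the next; the parity is that of the vertical hexagonal edges after the shift by
  \<open>place\<close>.\<close>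

lemma the_wall_vertical:
  assumes "k < length the_wall" "snd (the_wall ! k) \<noteq> N"
  shows "k mod 4 \<noteq> 0" "odd (k mod 4 + k div 4)"
proof -
  have "list_all (\<lambda>(k, h, v). v \<noteq> N \<longrightarrow> k mod 4 \<noteq> 0 \<and> odd (k mod 4 + k div 4)) (List.enumerate 0 the_wall)"
    by (simp add: the_wall_def)
  then have "\<forall>k<length the_wall. snd (the_wall ! k) \<noteq> N \<longrightarrow> k mod 4 \<noteq> 0 \<and> odd (k mod 4 + k div 4)"
    by (auto simp: list_all_length nth_enumerate_eq split_beta)
  with assms show "k mod 4 \<noteq> 0" "odd (k mod 4 + k div 4)"
    by blast+
qed

lemma inj_place: "inj place"
proof (rule injI)
  fix x y assume "place x = place y"
  then have "x mod 4 = y mod 4" "x div 4 = y div 4"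
    by (simp_all add: place_def)
  then show "x = y"
    by (metis div_mult_mod_eq)
qed

text \<open>Endpoints differ by 4 along a row and by 1 along a column, so they determine the list
  entry, which holds one direction only.\<close>

lemma wall_arcs_asym: "(x, y) \<in> wall_arcs ws \<Longrightarrow> (y, x) \<notin> wall_arcs ws"
proof -
  have orient: "(x, y) \<in> orient d i j \<longleftrightarrow> d = F \<and> x = i \<and> y = j \<or> d = B \<and> x = j \<and> y = i" for d i j x y
    by (cases d) auto
  show "(x, y) \<in> wall_arcs ws \<Longrightarrow> (y, x) \<notin> wall_arcs ws"
    by (auto simp: wall_arcs_def orient)
qed

text \<open>Locates each arc on a grid edge; unordered endpoints treat both directions at
  once.\<close>

lemma wall_arcsE:
  assumes "(x, y) \<in> wall_arcs the_wall"
  obtains k i j where "k < length the_wall"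
    "{x, y} = {k, k + 4} \<and> place k = (i, j) \<and> place (k + 4) = (i, j + 1) \<or>
     {x, y} = {k + 3, k + 4} \<and> place (k + 3) = (i, j) \<and> place (k + 4) = (i + 1, j) \<and> even (i + j)"
proof -
  obtain k where k: "k < length the_wall"
    "(x, y) \<in> orient (fst (the_wall ! k)) k (k + 4) \<union> orient (snd (the_wall ! k)) (k + 3) (k + 4)"
    using assms by (auto simp: wall_arcs_def)
  have orient: "{x, y} = {i, j} \<and> d \<noteq> N" if "(x, y) \<in> orient d i j" for d i j
    using that by (cases d) auto
  from k(2) show ?thesis
  proof
    assume "(x, y) \<in> orient (fst (the_wall ! k)) k (k + 4)"
    then have "{x, y} = {k, k + 4}"
      using orient by simp
    moreover have "place k = (k mod 4 + 1, k div 4 + 4)"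
      "place (k + 4) = (k mod 4 + 1, k div 4 + 4 + 1)"
      by (simp_all add: place_def)
    ultimately show ?thesis
      using k(1) that by blast
  next
    assume v: "(x, y) \<in> orient (snd (the_wall ! k)) (k + 3) (k + 4)"
    then have xy: "{x, y} = {k + 3, k + 4}" "snd (the_wall ! k) \<noteq> N"
      using orient by simp_all
    note vertical = the_wall_vertical[OF k(1) xy(2)]
    have "(k + 3) mod 4 + 1 = k mod 4" "(k + 3) div 4 = k div 4 + 1"
      using vertical(1) by presburger+
    then have "place (k + 3) = (k mod 4, k div 4 + 5)"
      "place (k + 4) = (k mod 4 + 1, k div 4 + 5)" "even (k mod 4 + (k div 4 + 5))"
      using vertical(2) by (simp_all add: place_def)
    then show ?thesis
      using k(1) xy(1) that by blast
  qed
qed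

lemma wall_arcs_less:
  assumes "(x, y) \<in> wall_arcs the_wall"
  shows "x < length the_wall + 4" "y < length the_wall + 4"
  using assms by (auto elim!: wall_arcsE simp: doubleton_eq_iff)

lemma is_orientation_wall: "is_orientation wall_orientation wall_graph"
proof -
  have "(v, u) \<notin> parcs wall_orientation" if "(u, v) \<in> parcs wall_orientation" for u v
    using that wall_arcs_asym inj_place by (auto simp: wall_orientation_def inj_eq)
  then show ?thesis
    by (auto simp: is_orientation_def wall_graph_def)
qed

lemma pair_graph_wall: "pair_graph wall_graph"
proof -
  have fin: "finite (pverts wall_graph)"
    by (simp add: wall_graph_def wall_orientation_def)
  have sub: "parcs wall_graph \<subseteq> pverts wall_graph \<times> pverts wall_graph"
    by (auto simp: wall_graph_def wall_orientation_def dest: wall_arcs_less)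
  have "finite (parcs wall_graph)"
    using fin sub by (meson finite_SigmaI finite_subset)
  moreover have "sym (parcs wall_graph)"
    by (auto simp: wall_graph_def sym_def)
  moreover have "(x, x) \<notin> wall_arcs the_wall" for x
    using wall_arcs_asym by blast
  then have "u \<noteq> v" if "(u, v) \<in> parcs wall_graph" for u v
    using that inj_place by (auto simp: wall_graph_def wall_orientation_def inj_eq)
  ultimately show ?thesis
    using fin sub by unfold_locales (auto simp: symmetric_def)
qed

lemma wall_graph_subgraph: "subgraph (with_proj wall_graph) (with_proj (hex_grid 3 13))"
proof -
  let ?H = "hex_grid 3 13"
  have place: "place k \<in> pverts ?H" if "k < length the_wall + 4" for k
  proof -
    \<comment> \<open>The columns run from 4 to 27, and 13 hexagons per row just suffice:
      \<open>j \<le> i + 26\<close> is tight at \<open>i = 1\<close>, \<open>j = 27\<close>.\<close>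
    have "k mod 4 < 4" "k div 4 < 24"
      using that length_the_wall by auto
    then show ?thesis
      by (auto simp: place_def hex_grid_def square_grid_def Let_def mk_symmetric_def)
  qed
  have verts: "pverts wall_graph \<subseteq> pverts ?H"
    using place by (auto simp: wall_graph_def wall_orientation_def)
  have arc: "((i, j), (i, j + 1)) \<in> parcs ?H" if "(i, j) \<in> pverts ?H" "(i, j + 1) \<in> pverts ?H" for i j
    using that by (auto simp: hex_grid_def Let_def mk_symmetric_with_proj_iff)
  have arc': "((i, j), (i + 1, j)) \<in> parcs ?H"
    if "(i, j) \<in> pverts ?H" "(i + 1, j) \<in> pverts ?H" "even (i + j)" for i j
    using that by (auto simp: hex_grid_def Let_def mk_symmetric_with_proj_iff)
  have sym: "(u, v) \<in> parcs ?H \<Longrightarrow> (v, u) \<in> parcs ?H" for u v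
    by (auto simp: hex_grid_def Let_def mk_symmetric_with_proj_iff)
  have "(place x, place y) \<in> parcs ?H" if "(x, y) \<in> wall_arcs the_wall" for x y
    using that
  proof (rule wall_arcsE)
    fix k i j
    assume "k < length the_wall" and
      "{x, y} = {k, k + 4} \<and> place k = (i, j) \<and> place (k + 4) = (i, j + 1) \<or>
       {x, y} = {k + 3, k + 4} \<and> place (k + 3) = (i, j) \<and> place (k + 4) = (i + 1, j) \<and> even (i + j)"
    then show ?thesis
      using place[of k] place[of "k + 3"] place[of "k + 4"] arc[of i j] arc'[of i j] sym
      by (auto simp: doubleton_eq_iff)
  qed
  then have "parcs wall_orientation \<subseteq> parcs ?H"
    by (auto simp: wall_orientation_def)
  then have "parcs wall_graph \<subseteq> parcs ?H"
    using sym by (auto simp: wall_graph_def)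
  moreover have "wf_digraph (with_proj wall_graph)" "wf_digraph (with_proj ?H)"
    using pair_graph_wall pair_graph_hex_grid
    by (auto simp: wf_digraph_wp_iff pair_graph_def pair_digraph_def pair_fin_digraph_def)
  ultimately show ?thesis
    using verts by (auto simp: subgraph_def compatible_def)
qed

section \<open>Impossibility of five colors and the lower bound\<close>

lemma not_oriented_coloring_wall: "\<not> oriented_coloring wall_orientation 5 \<phi>"
proof
  assume "oriented_coloring wall_orientation 5 \<phi>"
  then obtain T where T: "is_orientation T (complete_graph 5)" "is_digraph_hom \<phi> wall_orientation T"
    by (auto simp: oriented_coloring_def)
  have T': "pverts T = {..<5}" "asym (parcs T)" "total_on {..<5} (parcs T)"
    using T(1) by (simp_all add: is_orientation_complete_graph_iff)
  \<comment> \<open>Naming the vertices of \<open>T\<close> along this path puts the tournament into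
    the shape treated by \<open>killed\<close>.\<close>
  obtain xs where xs: "set xs = {..<5}" "distinct xs" "successively (\<lambda>u v. (u, v) \<in> parcs T) xs"
    using redei[of "{..<5}" "\<lambda>u v. (u, v) \<in> parcs T"] T'(3)
    by (auto simp: total_on_def)
  have "length xs = Suc (Suc (Suc (Suc (Suc 0))))"
    using distinct_card[OF xs(2)] xs(1) by simp
  then obtain a0 a1 a2 a3 a4 where a: "xs = [a0, a1, a2, a3, a4]"
    by (auto simp: length_Suc_conv)
  define \<sigma> where "\<sigma> = entry (Five a0 a1 a2 a3 a4)"
  define R where "R = (\<lambda>x y. (\<sigma> x, \<sigma> y) \<in> parcs T)"
  have \<sigma>: "\<sigma> C0 = a0" "\<sigma> C1 = a1" "\<sigma> C2 = a2" "\<sigma> C3 = a3" "\<sigma> C4 = a4"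
    by (simp_all add: \<sigma>_def)
  have "\<exists>x. \<sigma> x = z" if "z < 5" for z
  proof -
    have "z \<in> set xs"
      using that xs(1) by simp
    then show ?thesis
      unfolding a using \<sigma> by auto
  qed
  \<comment> \<open>\<open>\<tau>\<close> translates the numeric colors of \<open>\<phi>\<close>
    back into \<open>color\<close>.\<close>
  then obtain \<tau> where \<tau>: "\<And>z. z < 5 \<Longrightarrow> \<sigma> (\<tau> z) = z"
    by metis
  define c where "c = (\<lambda>k. \<tau> (\<phi> (place k)))"
  have "R (c x) (c y)" if "(x, y) \<in> wall_arcs the_wall" for x y
  proof -
    have "\<sigma> (c k) = \<phi> (place k)" if "k < length the_wall + 4" for k
      unfolding c_def using that T(2) T'(1)
      by (intro \<tau>) (auto simp: is_digraph_hom_def wall_orientation_def)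
    moreover have "(\<phi> (place x), \<phi> (place y)) \<in> parcs T"
      using T(2) \<open>(x, y) \<in> wall_arcs the_wall\<close>
      by (auto simp: is_digraph_hom_def wall_orientation_def)
    ultimately show ?thesis
      using wall_arcs_less[OF that] by (simp add: R_def)
  qed
  then have "realisable R Full the_wall \<noteq> Empty"
    by (rule mem_realisable[of the_wall R c, OF _ mem_Full])
  moreover have "R C0 C1" "R C1 C2" "R C2 C3" "R C3 C4"
    using xs(3) by (simp_all add: a R_def \<sigma>)
  moreover have "\<not> R x x" for x
    using asymD[OF T'(2)] by (auto simp: R_def)
  moreover have "R y x \<longleftrightarrow> \<not> R x y" if "x \<noteq> y" for x y
  proof -
    have "\<sigma> z \<in> set xs" for z
      by (cases z) (simp_all add: a \<sigma>)
    moreover have "\<sigma> x \<noteq> \<sigma> y"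
      using that xs(2) by (cases x; cases y) (auto simp: a \<sigma>)
    ultimately show ?thesis
      using T'(3) asymD[OF T'(2)] xs(1) unfolding R_def total_on_def by blast
  qed
  \<comment> \<open>These instances express every entry below the diagonal by its mirror image, as
    in the matrices of \<open>killed\<close>.\<close>
  from this[of C0 C1] this[of C0 C2] this[of C0 C3] this[of C0 C4] this[of C1 C2] this[of C1 C3]
    this[of C1 C4] this[of C2 C3] this[of C2 C4] this[of C3 C4]
  have "R C1 C0 \<longleftrightarrow> \<not> R C0 C1" "R C2 C0 \<longleftrightarrow> \<not> R C0 C2" "R C3 C0 \<longleftrightarrow> \<not> R C0 C3"
    "R C4 C0 \<longleftrightarrow> \<not> R C0 C4" "R C2 C1 \<longleftrightarrow> \<not> R C1 C2" "R C3 C1 \<longleftrightarrow> \<not> R C1 C3"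
    "R C4 C1 \<longleftrightarrow> \<not> R C1 C4" "R C3 C2 \<longleftrightarrow> \<not> R C2 C3" "R C4 C2 \<longleftrightarrow> \<not> R C2 C4"
    "R C4 C3 \<longleftrightarrow> \<not> R C3 C4"
    by simp_all
  ultimately have "\<not> killed [R C0 C2, R C0 C3, R C0 C4, R C1 C3, R C1 C4, R C2 C4]"
    by (simp add: realisable_def table_def del: rows.simps)
  then show False
    using killed_all by (auto simp: list_all_iff set_n_lists simp del: killed.simps)
qed

theorem theorem2:
  shows "oriented_chromatic_number_family hex_subgraphs \<ge> 6"
proof -
  have "wall_graph \<in> hex_subgraphs"
    using pair_graph_wall wall_graph_subgraph unfolding hex_subgraphs_def
    by (intro CollectI conjI exI[of _ 3] exI[of _ 13]) auto
  moreover have "(6 :: enat) \<le> enat (oriented_chromatic_number wall_graph)"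
    using oriented_chromatic_number_gtI[OF pair_graph_wall is_orientation_wall
        not_oriented_coloring_wall]
    by (simp add: numeral_eq_enat)
  ultimately show ?thesis
    unfolding oriented_chromatic_number_family_def by (rule SUP_upper2)
qed

end
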